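(* For every infinite cardinal number $\kappa$ there exist $2^\kappa$ pairwise non-embeddable F-universal groups of order $\kappa$. That is, there is a set $\mathcal{F}$ of F-universal groups, each of cardinality $\kappa$, with $|\mathcal{F}|=2^\kappa$, such that for any two distinct $G,H\in\mathcal{F}$ there is no injective group homomorphism from $G$ to $H$.
   Context: The order of a group $G$ is the cardinality $|G|$ of its underlying set. A group is called F-universal if every finite group embeds into it (i.e. every finite group is isomorphic to a subgroup of it). *)

theory Defs
  imports "HOL-Algebra.Group"
begin

unbundle cardinal_syntax

definition embeds_into :: "('a, 'c) monoid_scheme \<Rightarrow> ('b, 'd) monoid_scheme \<Rightarrow> bool"
  where "embeds_into G H \<longleftrightarrow> (\<exists>h. h \<in> mon G H)"

(* A definition cannot quantify over the type of the elements of H. Taking the finite groups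
   with elements in nat loses nothing, as F_universal_embeds below shows. *)
definition F_universal :: "('a, 'c) monoid_scheme \<Rightarrow> bool"
  where "F_universal G \<longleftrightarrow> group G \<and>
    (\<forall>H :: nat monoid. group H \<and> finite (carrier H) \<longrightarrow> embeds_into H G)"

lemma F_universal_embeds:
  fixes H :: "('b, 'd) monoid_scheme"
  assumes "F_universal G" "group H" "finite (carrier H)"
  shows "embeds_into H G"
proof -
  interpret H: group H by fact
  obtain f :: "'b \<Rightarrow> nat" where f: "inj_on f (carrier H)"
    using assms(3) finite_imp_inj_to_nat_seg by blast
  define g where "g = inv_into (carrier H) f"
  define N :: "nat monoid" where "N = \<lparr>carrier = f ` carrier H,
      monoid.mult = (\<lambda>x y. f (g x \<otimes>\<^bsub>H\<^esub> g y)), one = f \<one>\<^bsub>H\<^esub>\<rparr>"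
  have gf: "g (f x) = x" if "x \<in> carrier H" for x
    using f that by (simp add: g_def)
  have hom: "f \<in> hom H N"
    by (auto simp: hom_def N_def gf)
  have N: "group N"
  proof (rule groupI)
    fix x assume "x \<in> carrier N"
    then obtain a where a: "a \<in> carrier H" "x = f a" by (auto simp: N_def)
    then show "\<exists>y\<in>carrier N. y \<otimes>\<^bsub>N\<^esub> x = \<one>\<^bsub>N\<^esub>"
      by (intro bexI[of _ "f (inv\<^bsub>H\<^esub> a)"]) (auto simp: N_def gf)
  qed (auto simp: N_def gf H.m_assoc)
  then obtain h where "h \<in> mon N G"
    using assms by (auto simp: F_universal_def embeds_into_def N_def)
  then have "h \<circ> f \<in> mon H G"
    using mon_compose[of f H N h G] hom f by (auto simp: mon_def)
  then show ?thesis by (auto simp: embeds_into_def)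
qed

end

theory Submission
  imports Defs "HOL-Algebra.Free_Abelian_Groups" "HOL-Combinatorics.Cycles"
    "HOL-Computational_Algebra.Primes"
begin

text \<open>A properly coloured graph whose colours are primes is coded by a torsion-free nilpotent group
  of class 2: the quotient by a central subgroup is the direct sum over the vertices \<open>s\<close> of copies of
  \<open>\<int>[1/p]\<close>, where \<open>p\<close> is the colour of \<open>s\<close>, and the generators at \<open>s\<close> and \<open>t\<close> commute unless
  \<open>(s, t)\<close> is a non-edge between two colours. Under an embedding the image of the generator at \<open>s\<close>
  has \<open>p^k\<close>-th roots for all \<open>k\<close>, so its support consists of vertices of colour \<open>p\<close>, and for
  commuting generators of different colours the product of the two supports contains only edges.
  Choosing a point in each support gives a colour preserving graph homomorphism. The direct product
  with the finitary permutations of \<open>\<nat>\<close> makes the group F-universal; as this factor is torsion,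
  it does not disturb the argument.

  Countably many binary relations on a set can be coded by such a graph, so it remains to find
  \<open>2^\<kappa>\<close> relational structures on a set of size \<open>\<kappa>\<close> without homomorphisms between them. A
  well-order with a greatest element, together with a fixed cofinal sequence below each point of
  cofinality \<open>\<omega>\<close>, has no endomorphism but the identity: if \<open>f\<close> moves \<open>x\<close>, then the
  supremum \<open>b\<close> of the iterates \<open>f^n(x)\<close> is fixed, hence so is each member of the sequence below
  \<open>b\<close>, and a fixed point above \<open>x\<close> bounds all iterates. Marking a subset and its complement
  by unary predicates makes the structures for different subsets incomparable.\<close>

section \<open>Finitary permutations\<close>

lemma embeds_into_trans:
  "embeds_into G H \<Longrightarrow> embeds_into H K \<Longrightarrow> embeds_into G K"
  unfolding embeds_into_def using mon_compose by blast

text \<open>Transport of structure along \<open>g\<close>. It later moves the coding groups, whose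
  elements are functions, to the element type of \<kappa>.\<close>

lemma isomorphic_copy:
  fixes g :: "'b \<Rightarrow> 'c"
  assumes "group G" and inj: "inj_on g (carrier G)"
  obtains H :: "'c monoid"
  where "group H" "carrier H = g ` carrier G" "embeds_into G H" "embeds_into H G"
proof -
  interpret group G by fact
  define k where "k = inv_into (carrier G) g"
  define H :: "'c monoid" where "H = \<lparr>carrier = g ` carrier G,
      monoid.mult = (\<lambda>x y. g (k x \<otimes>\<^bsub>G\<^esub> k y)), one = g \<one>\<^bsub>G\<^esub>\<rparr>"
  have kg: "k (g x) = x" if "x \<in> carrier G" for x
    using inj that by (simp add: k_def)
  have "group H"
  proof (rule groupI)
    fix x assume "x \<in> carrier H"
    then obtain a where "a \<in> carrier G" "x = g a" by (auto simp: H_def)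
    then show "\<exists>y\<in>carrier H. y \<otimes>\<^bsub>H\<^esub> x = \<one>\<^bsub>H\<^esub>"
      by (intro bexI[of _ "g (inv\<^bsub>G\<^esub> a)"]) (auto simp: H_def kg)
  qed (auto simp: H_def kg m_assoc)
  moreover have "g \<in> mon G H"
    using inj by (auto simp: mon_def hom_def H_def kg)
  moreover have "k \<in> mon H G"
    by (auto simp: mon_def hom_def H_def kg inj_on_def)
  ultimately show thesis
    using that[of H] by (auto simp: embeds_into_def H_def)
qed

text \<open>\<open>permutation\<close> means a product of transpositions, so these are exactly the
  bijections that move finitely many points.\<close>

definition fin_perms :: "(nat \<Rightarrow> nat) monoid"
  where "fin_perms = \<lparr>carrier = {p. permutation p}, monoid.mult = (\<circ>), one = id\<rparr>"

lemma group_fin_perms: "group fin_perms"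
proof (rule groupI)
  fix p assume "p \<in> carrier fin_perms"
  then show "\<exists>q\<in>carrier fin_perms. q \<otimes>\<^bsub>fin_perms\<^esub> p = \<one>\<^bsub>fin_perms\<^esub>"
    by (intro bexI[of _ "inv_into UNIV p"])
      (auto simp: fin_perms_def permutation_inverse permutation_inverse_works)
qed (auto simp: fin_perms_def permutation_compose o_assoc)

lemma fin_perms_torsion:
  assumes "p \<in> carrier fin_perms"
  obtains n :: nat where "n > 0" "p [^]\<^bsub>fin_perms\<^esub> n = \<one>\<^bsub>fin_perms\<^esub>"
proof -
  have pow: "p [^]\<^bsub>fin_perms\<^esub> n = p ^^ n" for n :: nat
    by (induction n) (auto simp: fin_perms_def nat_pow_def funpow_swap1 fun_eq_iff)
  show thesis
    using permutation_is_nilpotent[of p] assms that by (auto simp: pow) (auto simp: fin_perms_def)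
qed

text \<open>A finitary permutation is determined by the part of its graph off the diagonal, a finite
  set of pairs.\<close>

lemma countable_fin_perms: "countable (carrier fin_perms)"
proof -
  let ?graph = "\<lambda>p :: nat \<Rightarrow> nat. {(x, p x) |x. p x \<noteq> x}"
  have "?graph ` carrier fin_perms \<subseteq> Fpow UNIV"
  proof (clarsimp simp: Fpow_def)
    fix p assume "p \<in> carrier fin_perms"
    then have "finite ((\<lambda>x. (x, p x)) ` {x. p x \<noteq> x})"
      by (intro finite_imageI permutation_finite_support) (simp add: fin_perms_def)
    then show "finite (?graph p)"
      by (simp add: image_Collect)
  qed
  moreover have "inj_on ?graph (carrier fin_perms)"
  proof (rule inj_onI, rule ext)
    fix p q x
    assume eq: "?graph p = ?graph q"
    have "p x = y" if "q x = y" "?graph p = ?graph q" for p q y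
    proof (rule ccontr)
      assume *: "p x \<noteq> y"
      then have "p x = x \<or> (x, p x) \<in> ?graph q" using that by blast
      then have "p x = x" using * that by auto
      then have "(x, y) \<in> ?graph q" using * that by auto
      then have "(x, y) \<in> ?graph p" using that by simp
      then show False using * by auto
    qed
    from this[OF refl eq] show "p x = q x" .
  qed
  ultimately show ?thesis
    by (meson countable_Fpow countableI_type countable_image_inj_on countable_subset)
qed

text \<open>Cayley's theorem: left translation on the carrier, extended by the identity.\<close>

lemma finite_group_embeds_fin_perms:
  fixes K :: "nat monoid"
  assumes "group K" and fin: "finite (carrier K)"
  shows "embeds_into K fin_perms"
proof -
  interpret group K by fact
  define L where "L g n = (if n \<in> carrier K then g \<otimes>\<^bsub>K\<^esub> n else n)" for g n
  have comp: "L g \<circ> L h = L (g \<otimes>\<^bsub>K\<^esub> h)" if "g \<in> carrier K" "h \<in> carrier K" for g h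
    using that by (auto simp: L_def m_assoc fun_eq_iff)
  have one: "L \<one>\<^bsub>K\<^esub> = id"
    by (auto simp: L_def fun_eq_iff)
  have "permutation (L g)" if "g \<in> carrier K" for g
  proof -
    have "bij (L g)"
      using comp[of g "inv\<^bsub>K\<^esub> g"] comp[of "inv\<^bsub>K\<^esub> g" g] one that
      by (intro o_bij[of "L (inv\<^bsub>K\<^esub> g)"]) auto
    moreover have "{n. L g n \<noteq> n} \<subseteq> carrier K"
      by (auto simp: L_def)
    ultimately show ?thesis
      using fin finite_subset by (auto simp: permutation)
  qed
  moreover have "inj_on L (carrier K)"
  proof (rule inj_onI)
    fix g h assume *: "g \<in> carrier K" "h \<in> carrier K" "L g = L h"
    then have "L g \<one>\<^bsub>K\<^esub> = L h \<one>\<^bsub>K\<^esub>" by simp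
    then show "g = h" using *(1,2) by (simp add: L_def)
  qed
  ultimately have "L \<in> mon K fin_perms"
    by (auto simp: mon_def hom_def fin_perms_def comp)
  then show ?thesis by (auto simp: embeds_into_def)
qed

section \<open>Nilpotent groups of coloured graphs\<close>

definition coeffs :: "nat \<Rightarrow> rat set"
  where "coeffs p = {x. \<exists>k. x * of_nat p ^ k \<in> \<int>}"

lemma coeffs_of_int [simp]: "of_int m \<in> coeffs p"
  unfolding coeffs_def by (auto intro: exI[of _ 0])

lemma coeffs_0 [simp]: "0 \<in> coeffs p" and coeffs_1 [simp]: "1 \<in> coeffs p"
  using coeffs_of_int[of 0] coeffs_of_int[of 1] by auto

lemma coeffs_uminus [simp]: "- x \<in> coeffs p \<longleftrightarrow> x \<in> coeffs p"
  by (simp add: coeffs_def)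

lemma coeffs_add:
  assumes "x \<in> coeffs p" "y \<in> coeffs p"
  shows "x + y \<in> coeffs p"
proof -
  obtain j k where "x * of_nat p ^ j \<in> \<int>" "y * of_nat p ^ k \<in> \<int>"
    using assms by (auto simp: coeffs_def)
  then have "(x * of_nat p ^ j) * of_nat p ^ k + (y * of_nat p ^ k) * of_nat p ^ j \<in> \<int>"
    by (meson Ints_add Ints_mult Ints_power Ints_of_nat)
  then have "(x + y) * of_nat p ^ (j + k) \<in> \<int>"
    by (simp add: algebra_simps power_add)
  then show ?thesis by (auto simp: coeffs_def)
qed

lemma coeffs_inverse_power: "p > 0 \<Longrightarrow> 1 / of_nat p ^ k \<in> coeffs p"
  by (auto simp: coeffs_def intro!: exI[of _ k])

text \<open>Clearing the denominator of \<open>x\<close>, a power of \<open>q\<close>, leaves an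
  integer \<open>N\<close>. As \<open>q\<close> is prime to \<open>p\<close>, every power of
  \<open>p\<close> divides \<open>N\<close>, which forces \<open>N = 0\<close>.\<close>

lemma coeffs_divisible:
  assumes "prime p" "prime q" "p \<noteq> q"
    and div: "\<And>k. \<exists>y\<in>coeffs q. x = of_nat (p ^ k) * y"
  shows "x = 0"
proof -
  obtain m where "x * of_nat q ^ m \<in> \<int>"
    using div[of 0] by (auto simp: coeffs_def)
  then obtain N where N: "x * of_nat q ^ m = of_int N"
    by (auto elim: Ints_cases)
  have dvd: "int p ^ k dvd N" for k
  proof -
    obtain y j where y: "x = of_nat (p ^ k) * y" "y * of_nat q ^ j \<in> \<int>"
      using div[of k] by (auto simp: coeffs_def)
    then obtain M where M: "y * of_nat q ^ j = of_int M"
      by (auto elim: Ints_cases)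
    have "(of_int (N * int q ^ j) :: rat) = x * of_nat q ^ m * of_nat q ^ j"
      by (simp add: N)
    also have "\<dots> = of_nat p ^ k * (y * of_nat q ^ j) * of_nat q ^ m"
      by (simp add: y)
    also have "\<dots> = of_int (int p ^ k * M * int q ^ m)"
      by (simp add: M)
    finally have "N * int q ^ j = int p ^ k * M * int q ^ m"
      by (simp only: of_int_eq_iff)
    then have "int p ^ k dvd N * int q ^ j"
      by simp
    moreover have "coprime (int p ^ k) (int q ^ j)"
      using primes_coprime[of "int p" "int q"] assms(1-3) by simp
    ultimately show ?thesis
      by (simp add: coprime_dvd_mult_left_iff)
  qed
  have "N = 0"
  proof (rule ccontr)
    assume "N \<noteq> 0"
    then have "int p ^ nat \<bar>N\<bar> \<le> \<bar>N\<bar>"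
      using dvd[of "nat \<bar>N\<bar>"] dvd_imp_le_int by force
    moreover have "int (nat \<bar>N\<bar>) < int (p ^ nat \<bar>N\<bar>)"
      using prime_gt_1_nat[OF \<open>prime p\<close>] by (simp only: of_nat_less_iff power_gt_expt)
    ultimately show False by simp
  qed
  then show ?thesis
    using N prime_gt_0_nat[OF \<open>prime q\<close>] by simp
qed

section \<open>Finitely supported functions and central extensions\<close>

definition fin_fun :: "'b set \<Rightarrow> ('b \<Rightarrow> rat) set"
  where "fin_fun X = {f. finite {s. f s \<noteq> 0} \<and> {s. f s \<noteq> 0} \<subseteq> X}"

lemma fin_fun_0 [simp]: "(\<lambda>_. 0) \<in> fin_fun X"
  by (simp add: fin_fun_def)

lemma fin_fun_uminus [simp]: "(\<lambda>s. - f s) \<in> fin_fun X \<longleftrightarrow> f \<in> fin_fun X"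
  by (simp add: fin_fun_def)

lemma fin_fun_add:
  assumes "f \<in> fin_fun X" "g \<in> fin_fun X"
  shows "(\<lambda>s. f s + g s) \<in> fin_fun X"
proof -
  have "{s. f s + g s \<noteq> 0} \<subseteq> {s. f s \<noteq> 0} \<union> {s. g s \<noteq> 0}" by auto
  then show ?thesis
    using assms unfolding fin_fun_def mem_Collect_eq
    by (meson Un_least finite_UnI finite_subset subset_trans)
qed

lemma fin_fun_diff: "f \<in> fin_fun X \<Longrightarrow> g \<in> fin_fun X \<Longrightarrow> (\<lambda>s. f s - g s) \<in> fin_fun X"
  using fin_fun_add[of f X "\<lambda>s. - g s"] by simp

text \<open>The bilinear cocycle of the extension: the tensor product of \<open>a\<close> and
  \<open>b\<close> with the coordinates outside \<open>N\<close> deleted.\<close>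

definition tensor :: "'s rel \<Rightarrow> ('s \<Rightarrow> rat) \<Rightarrow> ('s \<Rightarrow> rat) \<Rightarrow> 's \<times> 's \<Rightarrow> rat"
  where "tensor N a b = (\<lambda>q. if q \<in> N then a (fst q) * b (snd q) else 0)"

lemma tensor_scale: "tensor N (\<lambda>s. r * a s) b = (\<lambda>q. r * tensor N a b q)"
  by (auto simp: tensor_def)

lemma fin_fun_tensor:
  assumes "a \<in> fin_fun X" "b \<in> fin_fun X"
  shows "tensor N a b \<in> fin_fun (X \<times> X)"
proof -
  have "{q. tensor N a b q \<noteq> 0} \<subseteq> {s. a s \<noteq> 0} \<times> {s. b s \<noteq> 0}"
    by (auto simp: tensor_def split: if_splits)
  then show ?thesis
    using assms unfolding fin_fun_def mem_Collect_eq
    by (meson Sigma_mono finite_SigmaI finite_subset subset_trans)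
qed

text \<open>A generalised Heisenberg group. The central coordinates are arbitrary rationals, so
  products of coefficients of different colours stay inside.\<close>

definition heis :: "'s set \<Rightarrow> ('s \<Rightarrow> nat) \<Rightarrow> 's rel \<Rightarrow> (('s \<Rightarrow> rat) \<times> ('s \<times> 's \<Rightarrow> rat)) monoid"
  where "heis X c N = \<lparr>
    carrier = {a \<in> fin_fun X. \<forall>s. a s \<in> coeffs (c s)} \<times> fin_fun (X \<times> X),
    monoid.mult = (\<lambda>(a, z) (b, y). (\<lambda>s. a s + b s, \<lambda>q. z q + y q + tensor N a b q)),
    one = (\<lambda>_. 0, \<lambda>_. 0)\<rparr>"

lemma carrier_heis:
  "carrier (heis X c N) = {a \<in> fin_fun X. \<forall>s. a s \<in> coeffs (c s)} \<times> fin_fun (X \<times> X)"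
  by (simp add: heis_def)

lemma one_heis: "\<one>\<^bsub>heis X c N\<^esub> = (\<lambda>_. 0, \<lambda>_. 0)"
  by (simp add: heis_def)

lemma mult_heis:
  "(a, z) \<otimes>\<^bsub>heis X c N\<^esub> (b, y) = (\<lambda>s. a s + b s, \<lambda>q. z q + y q + tensor N a b q)"
  by (simp add: heis_def)

lemmas heis_simps = carrier_heis one_heis mult_heis

lemma group_heis: "group (heis X c N)"
proof (rule groupI)
  fix x assume "x \<in> carrier (heis X c N)"
  then show "\<exists>y\<in>carrier (heis X c N). y \<otimes>\<^bsub>heis X c N\<^esub> x = \<one>\<^bsub>heis X c N\<^esub>"
    \<comment> \<open>The summand \<open>tensor N (fst x) (fst x)\<close> cancels the cocycle of
      \<open>- fst x\<close> and \<open>fst x\<close>.\<close>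
    by (intro bexI[of _ "(\<lambda>s. - fst x s, \<lambda>q. - snd x q + tensor N (fst x) (fst x) q)"])
      (auto simp: heis_simps fin_fun_add fin_fun_diff fin_fun_tensor fun_eq_iff, auto simp: tensor_def)
next
  fix x y z
  show "x \<otimes>\<^bsub>heis X c N\<^esub> y \<otimes>\<^bsub>heis X c N\<^esub> z = x \<otimes>\<^bsub>heis X c N\<^esub> (y \<otimes>\<^bsub>heis X c N\<^esub> z)"
    by (cases x; cases y; cases z) (auto simp: heis_simps tensor_def algebra_simps fun_eq_iff)
qed (auto simp: heis_simps fin_fun_add fin_fun_tensor coeffs_add, auto simp: tensor_def)

lemma fst_pow_heis: "fst (x [^]\<^bsub>heis X c N\<^esub> (n :: nat)) = (\<lambda>s. of_nat n * fst x s)"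
proof (induction n)
  case (Suc n)
  then show ?case
    by (cases x; cases "x [^]\<^bsub>heis X c N\<^esub> n") (auto simp: nat_pow_Suc mult_heis algebra_simps)
qed (simp add: nat_pow_def one_heis)

text \<open>In general the central part of an \<open>n\<close>-th power also contains n(n-1)/2 times
  \<open>tensor N a a\<close>.\<close>

lemma pow_heis_isotropic:
  assumes "tensor N a a = (\<lambda>_. 0)"
  shows "(a, z) [^]\<^bsub>heis X c N\<^esub> (n :: nat) = (\<lambda>s. of_nat n * a s, \<lambda>q. of_nat n * z q)"
proof (induction n)
  case (Suc n)
  then show ?case
    using assms by (simp add: nat_pow_Suc mult_heis tensor_scale algebra_simps)
qed (simp add: nat_pow_def one_heis)

lemma pow_DirProd: "(x, y) [^]\<^bsub>G \<times>\<times> H\<^esub> (n :: nat) = (x [^]\<^bsub>G\<^esub> n, y [^]\<^bsub>H\<^esub> n)"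
  by (induction n) (auto simp: nat_pow_Suc nat_pow_def)

section \<open>Generators, commutators and embeddings\<close>

definition unit_at :: "'s \<Rightarrow> rat \<Rightarrow> 's \<Rightarrow> rat"
  where "unit_at s r = (\<lambda>t. if t = s then r else 0)"

lemma fin_fun_unit_at: "s \<in> X \<Longrightarrow> unit_at s r \<in> fin_fun X"
  by (auto simp: fin_fun_def unit_at_def intro: finite_subset[of _ "{s}"])

lemma coeffs_unit_at: "r \<in> coeffs (c s) \<Longrightarrow> unit_at s r t \<in> coeffs (c t)"
  by (simp add: unit_at_def)

text \<open>\<open>C\<close> is the commutator of \<open>x\<close> and \<open>y\<close>. The first
  component of the image of \<open>x\<close> is central, so the image of \<open>C\<close> lives in
  the torsion factor alone.\<close>

lemma commutator_of_central_part_torsion: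
  assumes hom: "\<phi> \<in> hom K (heis X c N \<times>\<times> fin_perms)" and "group K"
    and K: "x \<in> carrier K" "y \<in> carrier K" "C \<in> carrier K" "x \<otimes>\<^bsub>K\<^esub> y = C \<otimes>\<^bsub>K\<^esub> (y \<otimes>\<^bsub>K\<^esub> x)"
    and central: "fst (fst (\<phi> x)) = (\<lambda>_. 0)"
  obtains n :: nat
  where "n > 0" "\<phi> (C [^]\<^bsub>K\<^esub> n) = \<one>\<^bsub>heis X c N \<times>\<times> fin_perms\<^esub>"
proof -
  let ?H = "heis X c N" and ?P = "heis X c N \<times>\<times> fin_perms"
  interpret H: group ?H by (rule group_heis)
  interpret P: group ?P by (intro DirProd_group group_heis group_fin_perms)
  have \<phi>: "\<phi> u \<in> carrier ?P" if "u \<in> carrier K" for u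
    using hom that by (rule hom_in_carrier)
  define \<psi> where "\<psi> u = fst (\<phi> u)" for u
  have \<psi>_mult: "\<psi> (u \<otimes>\<^bsub>K\<^esub> v) = \<psi> u \<otimes>\<^bsub>?H\<^esub> \<psi> v" if "u \<in> carrier K" "v \<in> carrier K" for u v
    using hom that by (simp add: \<psi>_def hom_mult mult_DirProd')
  have \<psi>: "\<psi> u \<in> carrier ?H" if "u \<in> carrier K" for u
    using \<phi>[OF that] by (auto simp: \<psi>_def)
  have "\<psi> x \<otimes>\<^bsub>?H\<^esub> \<psi> y = \<psi> y \<otimes>\<^bsub>?H\<^esub> \<psi> x"
    using central by (cases "\<psi> x"; cases "\<psi> y") (auto simp: \<psi>_def mult_heis tensor_def fun_eq_iff)
  moreover have "\<psi> x \<otimes>\<^bsub>?H\<^esub> \<psi> y = \<psi> C \<otimes>\<^bsub>?H\<^esub> (\<psi> y \<otimes>\<^bsub>?H\<^esub> \<psi> x)"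
    using K \<open>group K\<close> by (metis \<psi>_mult group.is_monoid monoid.m_closed)
  ultimately have "\<psi> C = \<one>\<^bsub>?H\<^esub>"
    using \<psi> K by (metis H.m_closed H.r_cancel_one')
  moreover have "snd (\<phi> C) \<in> carrier fin_perms"
    using \<phi>[OF K(3)] by auto
  then obtain n :: nat where "n > 0" "snd (\<phi> C) [^]\<^bsub>fin_perms\<^esub> n = \<one>\<^bsub>fin_perms\<^esub>"
    by (rule fin_perms_torsion)
  ultimately have "\<phi> C [^]\<^bsub>?P\<^esub> n = \<one>\<^bsub>?P\<^esub>"
    by (cases "\<phi> C") (simp add: pow_DirProd \<psi>_def)
  then show thesis
    using that[OF \<open>n > 0\<close>] hom_nat_pow[OF hom K(3) \<open>group K\<close> P.is_group] by simp
qed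

text \<open>Choosing for every vertex \<open>s\<close> any point of the support of the image of the generator at
  \<open>s\<close> yields a graph homomorphism: supports avoid \<open>N'\<close> as whole rectangles.\<close>

lemma embedding_imp_graph_hom:
  assumes c: "\<And>s. prime (c s)"
    and N: "\<And>s t. (s, t) \<in> N \<Longrightarrow> (t, s) \<in> N" "\<And>s t. (s, t) \<in> N \<Longrightarrow> c s \<noteq> c t"
    and nbr: "\<And>s. s \<in> X \<Longrightarrow> \<exists>t\<in>X. (s, t) \<in> N"
    and emb: "embeds_into (heis X c N \<times>\<times> fin_perms) (heis X' c N' \<times>\<times> fin_perms)"
  obtains f where "\<And>s. s \<in> X \<Longrightarrow> f s \<in> X' \<and> c (f s) = c s"
    "\<And>s t. \<lbrakk>s \<in> X; t \<in> X; c s \<noteq> c t; (s, t) \<notin> N\<rbrakk> \<Longrightarrow> (f s, f t) \<notin> N'"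
proof -
  let ?G = "heis X c N \<times>\<times> fin_perms" and ?H' = "heis X' c N'"
  obtain \<phi> where hom: "\<phi> \<in> hom ?G (?H' \<times>\<times> fin_perms)" and inj: "inj_on \<phi> (carrier ?G)"
    using emb by (auto simp: embeds_into_def mon_def)
  interpret G: group ?G by (intro DirProd_group group_heis group_fin_perms)
  interpret P: group "?H' \<times>\<times> fin_perms" by (intro DirProd_group group_heis group_fin_perms)
  define \<psi> where "\<psi> u = fst (\<phi> u)" for u
  have \<psi>_hom: "\<psi> \<in> hom ?G ?H'"
    using hom by (auto simp: \<psi>_def hom_def mult_DirProd' Pi_iff mem_Times_iff)
  define e :: "'a \<Rightarrow> rat \<Rightarrow> (('a \<Rightarrow> rat) \<times> ('a \<times> 'a \<Rightarrow> rat)) \<times> (nat \<Rightarrow> nat)"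
    where "e s r = ((unit_at s r, \<lambda>_. 0), id)" for s r
  have e_carrier: "e s r \<in> carrier ?G" if "s \<in> X" "r \<in> coeffs (c s)" for s r
    using that fin_fun_unit_at[of s X r] coeffs_unit_at[of r c s]
    by (auto simp: e_def carrier_heis fin_perms_def)
  have e1: "e s 1 \<in> carrier ?G" if "s \<in> X" for s
    using that by (rule e_carrier) simp
  have N_irrefl: "(s, s) \<notin> N" for s
    using N(2) by blast
  have id_pow: "id [^]\<^bsub>fin_perms\<^esub> (n :: nat) = id" for n
    by (induction n) (auto simp: nat_pow_def fin_perms_def)
  have e_pow: "e s r [^]\<^bsub>?G\<^esub> (n :: nat) = e s (of_nat n * r)" for s r n
  proof -
    have "tensor N (unit_at s r) (unit_at s r) = (\<lambda>_. 0)"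
      using N_irrefl by (auto simp: tensor_def unit_at_def fun_eq_iff)
    then show ?thesis
      by (auto simp: e_def pow_DirProd pow_heis_isotropic id_pow unit_at_def)
  qed
  define a where "a s = fst (\<psi> (e s 1))" for s
  have supp: "t \<in> X' \<and> c t = c s" if s: "s \<in> X" and t: "a s t \<noteq> 0" for s t
  proof
    show "t \<in> X'"
      using hom_in_carrier[OF \<psi>_hom e1[OF s]] t by (auto simp: a_def carrier_heis fin_fun_def)
    show "c t = c s"
    proof (rule ccontr)
      assume ne: "c t \<noteq> c s"
      \<comment> \<open>The generator at \<open>s\<close> has the root
        \<open>e s (1 / c s ^ k)\<close> of order \<open>c s ^ k\<close>; the image of this root
        supplies \<open>y\<close>.\<close>
      have "\<exists>y\<in>coeffs (c t). a s t = of_nat (c s ^ k) * y" for k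
      proof -
        have pos: "c s > 0" using c prime_gt_0_nat by blast
        define r where "r = e s (1 / of_nat (c s) ^ k)"
        have r: "r \<in> carrier ?G"
          unfolding r_def using s pos by (intro e_carrier coeffs_inverse_power)
        have "r [^]\<^bsub>?G\<^esub> (c s ^ k) = e s 1"
          using pos by (simp add: r_def e_pow)
        then have "\<psi> (e s 1) = \<psi> r [^]\<^bsub>?H'\<^esub> (c s ^ k)"
          using hom_nat_pow[OF \<psi>_hom r G.is_group group_heis] by metis
        then have "a s t = of_nat (c s ^ k) * fst (\<psi> r) t"
          by (simp add: a_def fst_pow_heis)
        moreover have "fst (\<psi> r) t \<in> coeffs (c t)"
          using hom_in_carrier[OF \<psi>_hom r] by (auto simp: carrier_heis)
        ultimately show ?thesis by blast
      qed
      then show False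
        using coeffs_divisible[OF c c] ne t by metis
    qed
  qed
  have nonzero: "a s \<noteq> (\<lambda>_. 0)" if s: "s \<in> X" for s
  proof
    assume a0: "a s = (\<lambda>_. 0)"
    obtain t where t: "t \<in> X" "(s, t) \<in> N"
      using nbr s by blast
    \<comment> \<open>\<open>C\<close> is the commutator of the generators at \<open>s\<close> and
      \<open>t\<close>. It has infinite order because \<zeta> is 1 at \<open>(s, t)\<close>, so no
      positive power of it can be killed by the embedding.\<close>
    define \<zeta> where "\<zeta> = (\<lambda>q. tensor N (unit_at s 1) (unit_at t 1) q - tensor N (unit_at t 1) (unit_at s 1) q)"
    define C where "C = (((\<lambda>_. 0) :: 'a \<Rightarrow> rat, \<zeta>), id :: nat \<Rightarrow> nat)"
    have C: "C \<in> carrier ?G"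
      using s t by (auto simp: C_def \<zeta>_def carrier_heis fin_perms_def
          intro!: fin_fun_diff fin_fun_tensor fin_fun_unit_at)
    have "e s 1 \<otimes>\<^bsub>?G\<^esub> e t 1 = C \<otimes>\<^bsub>?G\<^esub> (e t 1 \<otimes>\<^bsub>?G\<^esub> e s 1)"
      by (auto simp: e_def C_def mult_heis \<zeta>_def tensor_def fin_perms_def fun_eq_iff)
    then obtain n :: nat where n: "n > 0" "\<phi> (C [^]\<^bsub>?G\<^esub> n) = \<one>\<^bsub>?H' \<times>\<times> fin_perms\<^esub>"
      using commutator_of_central_part_torsion[OF hom G.is_group e1[OF s] e1[OF t(1)] C] a0
      by (auto simp: a_def \<psi>_def)
    then have "\<phi> (C [^]\<^bsub>?G\<^esub> n) = \<phi> \<one>\<^bsub>?G\<^esub>"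
      by (simp only: hom_one[OF hom G.is_group P.is_group])
    then have "C [^]\<^bsub>?G\<^esub> n = \<one>\<^bsub>?G\<^esub>"
      by (rule inj_onD[OF inj _ G.nat_pow_closed[OF C] G.one_closed])
    moreover have "tensor N (\<lambda>_. 0) (\<lambda>_. 0) = (\<lambda>_. 0)"
      by (auto simp: tensor_def)
    ultimately have "of_nat n * \<zeta> (s, t) = 0"
      by (auto simp: C_def pow_DirProd pow_heis_isotropic one_heis fun_eq_iff)
    moreover have "\<zeta> (s, t) = 1"
      using t N_irrefl by (auto simp: \<zeta>_def tensor_def unit_at_def)
    ultimately show False
      using n by simp
  qed
  have "\<forall>s\<in>X. \<exists>t. a s t \<noteq> 0"
    using nonzero by auto
  then obtain f where f: "\<And>s. s \<in> X \<Longrightarrow> a s (f s) \<noteq> 0"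
    by metis
  show thesis
  proof (rule that)
    fix s t assume st: "s \<in> X" "t \<in> X" "c s \<noteq> c t" "(s, t) \<notin> N"
    show "(f s, f t) \<notin> N'"
    proof
      assume N': "(f s, f t) \<in> N'"
      \<comment> \<open>The two cocycles could be nonzero only at \<open>(s, t)\<close> and
        \<open>(t, s)\<close>, and by symmetry neither pair is in \<open>N\<close>. The images
        commute too, and are compared at \<open>(f s, f t)\<close>.\<close>
      have "e s 1 \<otimes>\<^bsub>?G\<^esub> e t 1 = e t 1 \<otimes>\<^bsub>?G\<^esub> e s 1"
        using st N(1) by (auto simp: e_def mult_heis tensor_def unit_at_def fin_perms_def fun_eq_iff)
      then have "\<psi> (e s 1) \<otimes>\<^bsub>?H'\<^esub> \<psi> (e t 1) = \<psi> (e t 1) \<otimes>\<^bsub>?H'\<^esub> \<psi> (e s 1)"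
        using hom_mult[OF \<psi>_hom] e1 st by metis
      then have "tensor N' (a s) (a t) (f s, f t) = tensor N' (a t) (a s) (f s, f t)"
        by (cases "\<psi> (e s 1)"; cases "\<psi> (e t 1)") (auto simp: a_def mult_heis fun_eq_iff)
      then have "a s (f s) * a t (f t) = a t (f s) * a s (f t)"
        using N' by (simp add: tensor_def)
      \<comment> \<open>\<open>f s\<close> has colour \<open>c s\<close>, hence lies outside the
        support of \<open>a t\<close>.\<close>
      moreover have "a t (f s) = 0"
        using supp f st by metis
      ultimately show False
        using f st by simp
    qed
  qed (use supp f in blast)
qed

section \<open>A rigid family of relational structures\<close>

text \<open>Monotonicity is not demanded, so in a well-order a successor has a ladder as well, a
  constant one.\<close>

definition is_ladder :: "'v rel \<Rightarrow> 'v \<Rightarrow> (nat \<Rightarrow> 'v) \<Rightarrow> bool"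
  where "is_ladder r b L \<longleftrightarrow>
    (\<forall>n. (L n, b) \<in> r - Id) \<and> (\<forall>x. (x, b) \<in> r - Id \<longrightarrow> (\<exists>n. (x, L n) \<in> r))"

text \<open>One ladder is fixed at each point that has any; splitting it by index turns the ladder
  system into countably many binary relations.\<close>

definition ladder_rel :: "'v rel \<Rightarrow> nat \<Rightarrow> 'v rel"
  where "ladder_rel r n = {((SOME L. is_ladder r b L) n, b) |b. \<exists>L. is_ladder r b L}"

lemma rigid_ladder_system:
  assumes wo: "Well_order r" and top: "\<And>x. x \<in> Field r \<Longrightarrow> (x, z) \<in> r"
    and f_in: "\<And>x. x \<in> Field r \<Longrightarrow> f x \<in> Field r"
    and f_less: "\<And>x y. (x, y) \<in> r - Id \<Longrightarrow> (f x, f y) \<in> r - Id"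
    and f_ladder: "\<And>n x y. (x, y) \<in> ladder_rel r n \<Longrightarrow> (f x, f y) \<in> ladder_rel r n"
    and x: "x \<in> Field r"
  shows "f x = x"
proof (rule ccontr)
  assume ne: "f x \<noteq> x"
  have tr: "trans r" and an: "antisym r" and wf: "wf (r - Id)"
    and tot: "\<And>x y. x \<in> Field r \<Longrightarrow> y \<in> Field r \<Longrightarrow> (x, y) \<in> r \<or> (y, x) \<in> r - Id"
    and rfl: "\<And>x. x \<in> Field r \<Longrightarrow> (x, x) \<in> r"
    using wo unfolding order_on_defs total_on_def refl_on_def by (blast, blast, blast, fast, blast)
  have FieldD: "u \<in> Field r \<and> v \<in> Field r" if "(u, v) \<in> r" for u v
    using that by (auto simp: Field_def)
  have le_less: "(u, w) \<in> r - Id" if "(u, v) \<in> r" "(v, w) \<in> r - Id" for u v w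
    using that tr an unfolding trans_def antisym_def by blast
  have less_le: "(u, w) \<in> r - Id" if "(u, v) \<in> r - Id" "(v, w) \<in> r" for u v w
    using that tr an unfolding trans_def antisym_def by blast
  have asym: False if "(u, v) \<in> r - Id" "(v, u) \<in> r" for u v
    using that an by (auto simp: antisym_def)
  have f_le: "(f u, f v) \<in> r" if "(u, v) \<in> r" for u v
    using that f_less[of u v] rfl f_in FieldD by (cases "u = v") auto
  \<comment> \<open>A least \<open>u\<close> with \<open>f u\<close> below \<open>u\<close> is
    impossible: \<open>f u\<close> would be a smaller such point.\<close>
  have inflate: "(u, f u) \<in> r" if "u \<in> Field r" for u
    using wf that
  proof (induction u rule: wf_induct_rule)
    case (less u)
    show ?case
    proof (rule ccontr)
      assume "(u, f u) \<notin> r"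
      then have *: "(f u, u) \<in> r - Id"
        using tot less.prems f_in by blast
      then have "(f (f u), f u) \<in> r - Id" by (rule f_less)
      moreover have "(f u, f (f u)) \<in> r"
        using less.IH[OF *] less.prems f_in by blast
      ultimately show False by (rule asym)
    qed
  qed
  define s where "s n = (f ^^ n) x" for n
  have s_Suc: "s (Suc n) = f (s n)" and s_in: "s n \<in> Field r" for n
    using x f_in by (induction n) (auto simp: s_def)
  have s_inc: "(s n, s (Suc n)) \<in> r - Id" for n
  proof (induction n)
    case 0
    then show ?case using inflate[OF x] ne by (simp add: s_def)
  next
    case (Suc n)
    then show ?case using f_less[OF Suc] by (simp add: s_Suc)
  qed
  \<comment> \<open>The strict upper bounds of the iterates. The greatest element \<open>z\<close>
    is one of them, so a least one, \<open>b\<close>, exists.\<close>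
  define B where "B = {b. \<forall>n. (s n, b) \<in> r - Id}"
  have "z \<in> B"
    using less_le[OF s_inc top[OF s_in]] by (auto simp: B_def)
  then obtain b where b: "b \<in> B" and b_min: "\<And>y. (y, b) \<in> r - Id \<Longrightarrow> y \<notin> B"
    using wf by (metis wfE_min)
  have s_b: "(s n, b) \<in> r - Id" for n
    using b by (auto simp: B_def)
  have s_cofinal: "\<exists>n. (y, s n) \<in> r" if y: "(y, b) \<in> r - Id" for y
  proof -
    obtain n where "(s n, y) \<notin> r - Id"
      using b_min[OF y] by (auto simp: B_def)
    then show ?thesis
      using tot[of y "s n"] s_in y FieldD by blast
  qed
  \<comment> \<open>The iterates only witness that \<open>b\<close> has a ladder; the fixed ladder
    \<open>L b\<close> may be a different one.\<close>
  have "is_ladder r b s"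
    using s_b s_cofinal by (auto simp: is_ladder_def)
  define L where "L b = (SOME L. is_ladder r b L)" for b
  have L: "is_ladder r b (L b)" if "is_ladder r b K" for b K
    unfolding L_def using that by (rule someI[where P = "is_ladder r b"])
  have in_rel: "(L b n, b) \<in> ladder_rel r n" for n
    using \<open>is_ladder r b s\<close> unfolding ladder_rel_def L_def by blast
  \<comment> \<open>In \<open>ladder_rel r n\<close> the second point determines the first.\<close>
  have fL: "f (L b n) = L (f b) n" and fb: "\<exists>K. is_ladder r (f b) K" for n
    using f_ladder[OF in_rel[of n]] by (auto simp: ladder_rel_def L_def)
  have lad: "is_ladder r b (L b)" "is_ladder r (f b) (L (f b))"
    using L \<open>is_ladder r b s\<close> fb by blast+
  have fL_less: "(f (L b n), b) \<in> r - Id" for n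
  proof -
    obtain m where "(L b n, s m) \<in> r"
      using s_cofinal[of "L b n"] lad(1) by (auto simp: is_ladder_def)
    then show ?thesis
      using le_less[OF f_le s_b[of "Suc m", unfolded s_Suc]] by blast
  qed
  have b_in: "b \<in> Field r" using s_b FieldD by blast
  \<comment> \<open>If \<open>b\<close> were below \<open>f b\<close>, the ladder at
    \<open>f b\<close> would reach \<open>b\<close>; but its members are the
    \<open>f (L b n)\<close>, which stay below \<open>b\<close>.\<close>
  have "f b = b"
  proof (rule ccontr)
    assume "f b \<noteq> b"
    then have "(b, f b) \<in> r - Id" using inflate[OF b_in] by simp
    then obtain n where "(b, L (f b) n) \<in> r"
      using lad by (auto simp: is_ladder_def)
    then show False using fL_less[of n] asym by (simp add: fL)
  qed
  then have fix_L: "f (L b n) = L b n" for n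
    by (simp add: fL)
  obtain n where n: "(x, L b n) \<in> r"
    using lad(1) s_b[of 0] by (auto simp: is_ladder_def s_def)
  have "(s m, L b n) \<in> r" for m
  proof (induction m)
    case (Suc m)
    then show ?case using f_le[OF Suc] by (simp add: s_Suc fix_L)
  qed (use n in \<open>simp add: s_def\<close>)
  moreover obtain m where "(L b n, s m) \<in> r"
    using lad(1) s_cofinal[of "L b n"] by (auto simp: is_ladder_def)
  ultimately show False
    using asym[OF less_le[OF s_inc]] by blast
qed

text \<open>An infinite cardinal has no greatest element, and rigidity needs one to bound the
  iterates; \<open>None\<close> is put on top.\<close>

lemma well_order_with_top:
  assumes "Well_order \<kappa>"
  defines "r \<equiv> dir_image \<kappa> Some Osum {(None, None)}"
  shows "Well_order r" "Field r = insert None (Some ` Field \<kappa>)"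
    "\<And>x. x \<in> Field r \<Longrightarrow> (x, None) \<in> r"
proof -
  have F: "Field {(None :: 'a option, None)} = {None}" "Field (dir_image \<kappa> Some) = Some ` Field \<kappa>"
    by (auto simp: dir_image_Field)
  have "Well_order {(None :: 'a option, None)}"
    by (auto simp: F order_on_defs refl_on_def trans_def antisym_def total_on_def)
  then show "Well_order r"
    unfolding r_def using assms(1)
    by (intro Osum_Well_order Well_order_dir_image) (auto simp: F)
  show "Field r = insert None (Some ` Field \<kappa>)"
    by (auto simp: r_def Field_Osum F)
  then show "(x, None) \<in> r" if "x \<in> Field r" for x
    using that by (auto simp: r_def Osum_def F)
qed

section \<open>Coding relational structures by groups\<close>

definition colour :: "'v \<times> nat \<Rightarrow> nat"
  where "colour s = enumerate {p. prime p} (snd s)"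

lemma prime_colour: "prime (colour s)"
  using enumerate_in_set[OF primes_infinite, of "snd s"] by (simp add: colour_def)

lemma colour_eq_iff: "colour s = colour t \<longleftrightarrow> snd s = snd t"
  unfolding colour_def
  using strict_mono_eq[OF strict_mono_enumerate[OF primes_infinite]] by blast

text \<open>Every point \<open>v\<close> of a relational structure is represented by one vertex in each colour.
  Colour 0 is matched with all the other colours, which forces a graph homomorphism to act on
  all colours by the same map; the \<open>n\<close>-th relation is put between colours 1 and \<open>n + 2\<close>.\<close>

definition edges :: "(nat \<Rightarrow> 'v rel) \<Rightarrow> ('v \<times> nat) rel"
  where "edges R = {((v, 0), (v, j)) |v j. True} \<union> {((v, 1), (w, n + 2)) |v w n. (v, w) \<in> R n}"

text \<open>Pairs of equal colour are left out because supports of images are kept apart only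
  between different colours.\<close>

definition nonedges :: "(nat \<Rightarrow> 'v rel) \<Rightarrow> ('v \<times> nat) rel"
  where "nonedges R = {(s, t). snd s \<noteq> snd t \<and> (s, t) \<notin> edges R \<and> (t, s) \<notin> edges R}"

definition structure_group ::
    "'v set \<Rightarrow> (nat \<Rightarrow> 'v rel) \<Rightarrow>
      (((('v \<times> nat \<Rightarrow> rat) \<times> (('v \<times> nat) \<times> ('v \<times> nat) \<Rightarrow> rat)) \<times> (nat \<Rightarrow> nat)) monoid)"
  where "structure_group A R = heis (A \<times> UNIV) colour (nonedges R) \<times>\<times> fin_perms"

lemma group_structure_group: "group (structure_group A R)"
  unfolding structure_group_def by (intro DirProd_group group_heis group_fin_perms)

lemma finite_group_embeds_structure_group:
  fixes K :: "nat monoid"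
  assumes "group K" "finite (carrier K)"
  shows "embeds_into K (structure_group A R)"
proof -
  interpret heis: group "heis (A \<times> UNIV) colour (nonedges R)"
    by (rule group_heis)
  have "embeds_into fin_perms (structure_group A R)"
    unfolding embeds_into_def structure_group_def
    by (intro exI[of _ "\<lambda>p. (\<one>\<^bsub>heis (A \<times> UNIV) colour (nonedges R)\<^esub>, p)"])
      (auto simp: mon_def hom_def inj_on_def)
  then show ?thesis
    using finite_group_embeds_fin_perms[OF assms] embeds_into_trans by blast
qed

lemma structure_group_embedding:
  assumes two: "x \<in> A" "y \<in> A" "x \<noteq> y"
    and emb: "embeds_into (structure_group A R) (structure_group A R')"
  obtains g where "\<And>v. v \<in> A \<Longrightarrow> g v \<in> A"
    "\<And>n v w. \<lbrakk>v \<in> A; w \<in> A; (v, w) \<in> R n\<rbrakk> \<Longrightarrow> (g v, g w) \<in> R' n"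
proof -
  have nbr: "\<exists>t\<in>A \<times> UNIV. (s, t) \<in> nonedges R" if "s \<in> A \<times> UNIV" for s
  proof -
    obtain v i where s: "s = (v, i)" by fastforce
    obtain w where "w \<in> A" "w \<noteq> v" using two by metis
    then show ?thesis
      \<comment> \<open>Colour 0 meets the other colours only in the matching, so a vertex over a
        different point \<open>w\<close> is a non-neighbour.\<close>
      by (intro bexI[of _ "(w, if i = 0 then 1 else 0)"]) (auto simp: s nonedges_def edges_def)
  qed
  obtain f where f: "\<And>s. s \<in> A \<times> UNIV \<Longrightarrow> f s \<in> A \<times> UNIV \<and> colour (f s) = colour s"
    "\<And>s t. \<lbrakk>s \<in> A \<times> UNIV; t \<in> A \<times> UNIV; colour s \<noteq> colour t; (s, t) \<notin> nonedges R\<rbrakk>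
      \<Longrightarrow> (f s, f t) \<notin> nonedges R'"
    using embedding_imp_graph_hom[where c = colour and X = "A \<times> UNIV" and X' = "A \<times> UNIV"
        and N = "nonedges R" and N' = "nonedges R'", OF prime_colour _ _ nbr
        emb[unfolded structure_group_def]]
    by (auto simp: nonedges_def colour_eq_iff)
  define g where "g i v = fst (f (v, i))" for i v
  have g: "f (v, i) = (g i v, i)" "g i v \<in> A" if "v \<in> A" for v i
    using f(1)[of "(v, i)"] that by (auto simp: g_def colour_eq_iff prod_eq_iff mem_Times_iff)
  have edge: "((g i v, i), (g j w, j)) \<in> edges R' \<or> ((g j w, j), (g i v, i)) \<in> edges R'"
    if "v \<in> A" "w \<in> A" "i \<noteq> j" "((v, i), (w, j)) \<in> edges R" for i j v w
    using f(2)[of "(v, i)" "(w, j)"] that by (auto simp: g colour_eq_iff nonedges_def)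
  \<comment> \<open>The images of the matched vertices \<open>(v, 0)\<close> and
    \<open>(v, j)\<close> are adjacent, hence matched again.\<close>
  have g0: "g j v = g 0 v" if "v \<in> A" for j v
    using edge[of v v 0 j] that by (cases "j = 0") (auto simp: edges_def)
  show thesis
  proof (rule that[of "g 0"])
    fix n v w assume "v \<in> A" "w \<in> A" "(v, w) \<in> R n"
    then have "((g 0 v, 1), (g 0 w, n + 2)) \<in> edges R' \<or> ((g 0 w, n + 2), (g 0 v, 1)) \<in> edges R'"
      using edge[of v w 1 "n + 2"] g0[of v 1] g0[of w "n + 2"] by (auto simp: edges_def)
    \<comment> \<open>Edges start in colour 0 or 1, so the reversed alternative is void, and colour
      \<open>n + 2\<close> identifies the relation.\<close>
    then show "(g 0 v, g 0 w) \<in> R' n"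
      by (auto simp: edges_def)
  qed (use g in blast)
qed

section \<open>Cardinality of the coding groups\<close>

context
  fixes \<kappa> :: "'c rel"
  assumes \<kappa>: "Cinfinite \<kappa>"
begin

lemma infinite_Field: "infinite (Field \<kappa>)"
  using \<kappa> by (simp add: cinfinite_def)

lemma Times_ordLeq: "|A| \<le>o \<kappa> \<Longrightarrow> |B| \<le>o \<kappa> \<Longrightarrow> |A \<times> B| \<le>o \<kappa>"
  using \<kappa> infinite_Field by (blast intro: card_of_Times_ordLeq_infinite_Field)

lemma countable_ordLeq:
  assumes "countable A"
  shows "|A| \<le>o \<kappa>"
proof -
  have "|A| \<le>o |UNIV :: nat set|"
    using assms card_of_ordLeq[of A "UNIV :: nat set"] by (auto simp: countable_def)
  also have "|UNIV :: nat set| =o natLeq"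
    by (rule card_of_nat)
  also have "natLeq \<le>o \<kappa>"
    using \<kappa> by (rule natLeq_ordLeq_cinfinite)
  finally show ?thesis .
qed

text \<open>A finitely supported function is determined by its graph over the support, a finite
  subset of \<open>X\<close> times the rationals; an infinite set has only as many finite subsets as
  elements.\<close>

lemma fin_fun_ordLeq:
  assumes "|X| \<le>o \<kappa>"
  shows "|fin_fun X| \<le>o \<kappa>"
proof -
  let ?graph = "\<lambda>f :: 'd \<Rightarrow> rat. {(s, f s) |s. f s \<noteq> 0}"
  have "finite (?graph f)" if "finite {s. f s \<noteq> 0}" for f
  proof -
    have "?graph f = (\<lambda>s. (s, f s)) ` {s. f s \<noteq> 0}" by auto
    then show ?thesis using that by simp
  qed
  then have img: "?graph ` fin_fun X \<subseteq> Fpow (X \<times> UNIV)"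
    by (auto simp: fin_fun_def Fpow_def)
  have inj: "inj_on ?graph (fin_fun X)"
  proof (rule inj_onI, rule ext)
    fix f g s assume "?graph f = ?graph g"
    then have "(s, f s) \<in> ?graph f \<longleftrightarrow> (s, f s) \<in> ?graph g" "(s, g s) \<in> ?graph f \<longleftrightarrow> (s, g s) \<in> ?graph g"
      by blast+
    then show "f s = g s" by auto
  qed
  have "|fin_fun X| \<le>o |Fpow (X \<times> (UNIV :: rat set))|"
    using inj img card_of_ordLeq by blast
  also have "|Fpow (X \<times> (UNIV :: rat set))| \<le>o |Fpow (Field \<kappa>)|"
    using Times_ordLeq[OF assms countable_ordLeq[of "UNIV :: rat set"]] \<kappa>
    by (intro card_of_Fpow_mono) (meson card_of_Field_ordIso countableI_type ordIso_symmetric ordLeq_ordIso_trans)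
  also have "|Fpow (Field \<kappa>)| =o |Field \<kappa>|"
    using infinite_Field by (rule card_of_Fpow_infinite)
  also have "|Field \<kappa>| =o \<kappa>"
    using \<kappa> by (simp add: card_of_Field_ordIso)
  finally show ?thesis .
qed

lemma card_structure_group:
  assumes A: "|A| =o \<kappa>"
  shows "|carrier (structure_group A R)| =o \<kappa>"
proof -
  let ?X = "A \<times> (UNIV :: nat set)"
  have "|A| \<le>o \<kappa>" using A by (rule ordIso_imp_ordLeq)
  then have X: "|?X| \<le>o \<kappa>"
    by (intro Times_ordLeq countable_ordLeq[of UNIV]) auto
  have "carrier (structure_group A R) \<subseteq> (fin_fun ?X \<times> fin_fun (?X \<times> ?X)) \<times> carrier fin_perms"
    by (auto simp: structure_group_def carrier_heis)
  then have "|carrier (structure_group A R)| \<le>o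
      |(fin_fun ?X \<times> fin_fun (?X \<times> ?X)) \<times> carrier fin_perms|"
    by (rule card_of_mono1)
  also have "|(fin_fun ?X \<times> fin_fun (?X \<times> ?X)) \<times> carrier fin_perms| \<le>o \<kappa>"
    by (intro Times_ordLeq fin_fun_ordLeq X countable_ordLeq[OF countable_fin_perms])
  finally have "|carrier (structure_group A R)| \<le>o \<kappa>" .
  moreover have "\<kappa> \<le>o |carrier (structure_group A R)|"
  proof -
    let ?e = "\<lambda>v. ((unit_at (v, 0) 1, \<lambda>_. 0), id)"
    have "?e ` A \<subseteq> carrier (structure_group A R)"
      by (auto simp: structure_group_def carrier_heis fin_perms_def
          intro!: fin_fun_unit_at coeffs_unit_at)
    moreover have "inj_on ?e A"
      by (auto simp: inj_on_def unit_at_def fun_eq_iff split: if_splits)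
    ultimately have "|A| \<le>o |carrier (structure_group A R)|"
      using card_of_ordLeq by blast
    then show ?thesis
      using A ordIso_ordLeq_trans ordIso_symmetric by blast
  qed
  ultimately show ?thesis
    by (simp add: ordIso_iff_ordLeq)
qed

end

section \<open>The incomparable structures and the family of groups\<close>

text \<open>Unary predicates become parts of the diagonal. Homomorphisms need not reflect relations,
  so the complement of \<open>S\<close> is marked too; the order is strict so that they are strictly
  increasing.\<close>

definition marked_ladder_system :: "'v rel \<Rightarrow> 'v set \<Rightarrow> nat \<Rightarrow> 'v rel"
  where "marked_ladder_system r S n =
    (if n = 0 then r - Id else if n = 1 then Id_on S else if n = 2 then Id_on (Field r - S)
     else ladder_rel r (n - 3))"

lemma ladder_rel_subset: "ladder_rel r n \<subseteq> Field r \<times> Field r"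
proof -
  have "(L n, b) \<in> r" if "is_ladder r b L" for b L
    using that by (simp add: is_ladder_def)
  then show ?thesis
    unfolding ladder_rel_def by (auto intro: FieldI1 FieldI2 dest: someI[where P = "is_ladder r _"])
qed

text \<open>By rigidity the induced map of structures is the identity, which must carry each mark to
  the corresponding mark.\<close>

lemma marked_ladder_system_embedding:
  assumes wo: "Well_order r" and top: "\<And>x. x \<in> Field r \<Longrightarrow> (x, z) \<in> r"
    and two: "x \<in> Field r" "y \<in> Field r" "x \<noteq> y"
    and S: "S \<subseteq> Field r" "T \<subseteq> Field r"
    and emb: "embeds_into (structure_group (Field r) (marked_ladder_system r S))
                (structure_group (Field r) (marked_ladder_system r T))"
  shows "S = T"
proof -
  obtain g where g: "\<And>v. v \<in> Field r \<Longrightarrow> g v \<in> Field r"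
    "\<And>n v w. \<lbrakk>v \<in> Field r; w \<in> Field r; (v, w) \<in> marked_ladder_system r S n\<rbrakk>
      \<Longrightarrow> (g v, g w) \<in> marked_ladder_system r T n"
    using structure_group_embedding[OF two emb] by metis
  have id: "g v = v" if "v \<in> Field r" for v
  proof (rule rigid_ladder_system[OF wo top g(1) _ _ that])
    show "(g v, g w) \<in> r - Id" if "(v, w) \<in> r - Id" for v w
      using g(2)[of v w 0] that by (auto simp: marked_ladder_system_def Field_def)
    show "(g v, g w) \<in> ladder_rel r n" if "(v, w) \<in> ladder_rel r n" for n v w
      using g(2)[of v w "n + 3"] that ladder_rel_subset[of r n]
      by (auto simp: marked_ladder_system_def)
  qed
  have "v \<in> T" if "v \<in> S" for v
    using g(2)[of v v 1] id that S by (auto simp: marked_ladder_system_def)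
  moreover have "v \<notin> T" if "v \<in> Field r" "v \<notin> S" for v
    using g(2)[of v v 2] id that S by (auto simp: marked_ladder_system_def)
  ultimately show ?thesis
    using S by blast
qed

theorem theorem1:
  fixes \<kappa> :: "'a rel"
  assumes "Cinfinite \<kappa>"
  shows "\<exists>\<F> :: 'a monoid set.
           (\<forall>G\<in>\<F>. F_universal G \<and> |carrier G| =o \<kappa>) \<and>
           |\<F>| =o ctwo ^c \<kappa> \<and>
           (\<forall>G\<in>\<F>. \<forall>H\<in>\<F>. G \<noteq> H \<longrightarrow> \<not> embeds_into G H)"
proof -
  have inf: "infinite (Field \<kappa>)" and card: "Card_order \<kappa>" and wo: "Well_order \<kappa>"
    using assms unfolding cinfinite_def card_order_on_def by blast+
  define r where "r = dir_image \<kappa> Some Osum {(None, None)}"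
  note r = well_order_with_top[OF wo, folded r_def]
  have "insert None (Some ` Field \<kappa>) \<approx> Some ` Field \<kappa>"
    using inf by (intro infinite_insert_eqpoll) (simp add: finite_image_iff)
  also have "Some ` Field \<kappa> \<approx> Field \<kappa>"
    by (simp add: inj_on_image_eqpoll_self)
  finally have "|Field r| =o |Field \<kappa>|"
    by (simp add: r eqpoll_iff_card_of_ordIso)
  then have "|Field r| =o \<kappa>"
    using card card_of_Field_ordIso ordIso_transitive by blast
  \<comment> \<open>The structures live on \<open>Field r\<close>, so a subset of
    \<open>Field \<kappa>\<close> is moved there by \<open>Some\<close>; the added top is never in
    the marked set.\<close>
  define G where "G S = structure_group (Field r) (marked_ladder_system r (Some ` S))" for S
  have card_G: "|carrier (G S)| =o \<kappa>" for S
    unfolding G_def by (rule card_structure_group[OF assms \<open>|Field r| =o \<kappa>\<close>])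
  have "infinite (Field r)"
    using inf by (simp add: r finite_image_iff)
  then obtain x y where two: "x \<in> Field r" "y \<in> Field r" "x \<noteq> y"
    by (metis finite.emptyI finite_insert finite_subset insertCI subsetI)
  have G_eq: "S = T" if "embeds_into (G S) (G T)" "S \<subseteq> Field \<kappa>" "T \<subseteq> Field \<kappa>" for S T
  proof -
    have "Some ` S = Some ` T"
      using that by (intro marked_ladder_system_embedding[OF r(1,3) two]) (auto simp: r(2) G_def)
    then show ?thesis by (simp add: inj_image_eq_iff)
  qed
  \<comment> \<open>Embeddings in both directions are enough, since they carry over both
    universality and incomparability.\<close>
  have "\<exists>H :: 'a monoid. group H \<and> |carrier H| =o \<kappa> \<and> embeds_into (G S) H \<and> embeds_into H (G S)" for S
  proof -
    have "|carrier (G S)| =o |Field \<kappa>|"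
      using card_G card card_of_Field_ordIso ordIso_symmetric ordIso_transitive by blast
    then obtain g where g: "bij_betw g (carrier (G S)) (Field \<kappa>)"
      using card_of_ordIso by blast
    have "group (G S)" by (simp add: G_def group_structure_group)
    then obtain H :: "'a monoid" where "group H" "carrier H = g ` carrier (G S)"
      "embeds_into (G S) H" "embeds_into H (G S)"
      by (rule isomorphic_copy[OF _ bij_betw_imp_inj_on[OF g]])
    then show ?thesis
      using g card card_of_Field_ordIso by (metis bij_betw_imp_surj_on)
  qed
  then obtain H :: "'a set \<Rightarrow> 'a monoid" where H: "\<And>S. group (H S)" "\<And>S. |carrier (H S)| =o \<kappa>"
    "\<And>S. embeds_into (G S) (H S)" "\<And>S. embeds_into (H S) (G S)"
    by metis
  have H_eq: "S = T" if "embeds_into (H S) (H T)" "S \<subseteq> Field \<kappa>" "T \<subseteq> Field \<kappa>" for S T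
    using G_eq that H(3,4) embeds_into_trans by metis
  have univ: "F_universal (H S)" for S
    unfolding F_universal_def
    using H(1,3) finite_group_embeds_structure_group embeds_into_trans unfolding G_def by blast
  \<comment> \<open>Equal groups embed into each other by the identity, so \<open>H_eq\<close> also
    counts the family.\<close>
  have "inj_on H (Pow (Field \<kappa>))"
  proof (rule inj_onI)
    fix S T assume *: "S \<in> Pow (Field \<kappa>)" "T \<in> Pow (Field \<kappa>)" "H S = H T"
    have "embeds_into (H S) (H S)"
      unfolding embeds_into_def mon_def by (intro exI[of _ id]) (auto simp: hom_def)
    then show "S = T"
      using * H_eq by auto
  qed
  then have "|H ` Pow (Field \<kappa>)| =o |Pow (Field \<kappa>)|"
    by (meson card_of_ordIso inj_on_imp_bij_betw ordIso_symmetric)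
  also have "|Pow (Field \<kappa>)| =o ctwo ^c \<kappa>"
    unfolding ctwo_def cexp_def Field_card_of by (rule card_of_Pow_Func)
  finally have "|H ` Pow (Field \<kappa>)| =o ctwo ^c \<kappa>" .
  then show ?thesis
    using H(2) univ H_eq by (intro exI[of _ "H ` Pow (Field \<kappa>)"]) blast
qed

end
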